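(* Let $R$ be a commutative ring with identity containing an element $i$ with $i^2=-1$, let $N\ge 2$ be an integer, and let $n$ be the largest integer $\le N/2$. For $\varepsilon = (\varepsilon_1,\ldots,\varepsilon_n)\in\{\pm1\}^n$ and an $n$-tuple $a=(a_1,\ldots,a_n)$ of non-negative integers, set $$Y_{\varepsilon,a} = (X_1+i\varepsilon_1X_2)^{a_1}(X_3+i\varepsilon_2X_4)^{a_2}\cdots(X_{2n-1}+i\varepsilon_nX_{2n})^{a_n}\in R[X_1,\ldots,X_N].$$ (a) For each $j\in\{1,\ldots,n\}$, $M_{2j-1,2j}(Y_{\varepsilon,a}) = i\varepsilon_ja_jY_{\varepsilon,a}$. Conversely, suppose in addition that $R$ is an integral domain (containing $i$) in which $2$ is invertible. (b) Every $Y\in R[X_1,\ldots,X_N]$ that is an eigenvector of all of $M_{12},M_{34},\ldots,M_{2n-1,2n}$ is of the form $$Y = Y_{\varepsilon,a}\,q(X_1^2+X_2^2,\ldots,X_{2n-1}^2+X_{2n}^2)$$ for some $\varepsilon\in\{\pm1\}^n$, some $n$-tuple $a$ of non-negative integers, and some $q\in R_*[T_1,\ldots,T_n]$, where $R_*=R$ if $N=2n$ and $R_*=R[X_{2n+1}]$ if $N=2n+1$. In particular, such a $Y$ is an $R$-multiple of $Y_{\varepsilon,a}$ if $Y$ is homogeneous of degree $|a|=a_1+\cdots+a_n$. (c) Moreover, for all $\varepsilon\in\{\pm1\}^n$ and all $n$-tuples $a=(a_1,\ldots,a_n)$ of non-negative integers, $\Delta_NY_{\varepsilon,a}=0$ (with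 $Y_{\varepsilon,a}$ homogeneous of degree $|a|$), and $Y_{\varepsilon,a}$ is an eigenvector of $M\cdot M$.
   Context: $M_{jk}=X_j\partial_k-X_k\partial_j$ for distinct $j,k\in\{1,\ldots,N\}$, where $\partial_j=\partial/\partial X_j$; $M\cdot M=\sum_{\{j,k\}}M_{jk}^2$, the sum over all $2$-element subsets $\{j,k\}$ of $\{1,\ldots,N\}$ (well defined since $M_{jk}=-M_{kj}$); $\Delta_N=\partial_1^2+\cdots+\partial_N^2$. All are $R$-linear operators on $R[X_1,\ldots,X_N]$. An eigenvector of an operator $T$ is a nonzero $p$ with $Tp=\lambda p$ for some $\lambda\in R$.
   Formalization: The claim in (b) that every joint eigenvector Y has the form Y_{ε,a} q(...) is proved for R of characteristic 0; it fails in every odd characteristic p, e.g. R = F_5, N = 2, Y = X_1^5 satisfies M_12 Y = 0 but is not of that form. *)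

theory Defs
  imports "HOL-Library.Poly_Mapping" "HOL-Library.FuncSet"
begin

text \<open>
  Polynomials over \<open>'a\<close> in variables indexed by the natural numbers: finitely supported
  coefficient functions on monomials, a monomial being a finitely supported exponent
  function. Multiplication is the convolution product of Poly_Mapping. The ring
  \<open>R[X_k | k \<in> V]\<close> is the subring \<open>polys V\<close>; in particular \<open>polys {}\<close> is the copy of \<open>R\<close>
  formed by the constants, and \<open>R[X_1,...,X_N]\<close> is \<open>polys {1..N}\<close>.
\<close>

type_synonym 'a mpoly = "(nat \<Rightarrow>\<^sub>0 nat) \<Rightarrow>\<^sub>0 'a"

definition polys :: "nat set \<Rightarrow> 'a::zero mpoly set"
  where "polys V = {p. \<forall>m\<in>Poly_Mapping.keys p. Poly_Mapping.keys m \<subseteq> V}"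

definition Const :: "'a::zero \<Rightarrow> 'a mpoly"
  where "Const c = Poly_Mapping.single 0 c"

definition Var :: "nat \<Rightarrow> 'a::zero_neq_one mpoly"
  where "Var k = Poly_Mapping.single (Poly_Mapping.single k 1) 1"

definition mdeg :: "(nat \<Rightarrow>\<^sub>0 nat) \<Rightarrow> nat"
  where "mdeg m = (\<Sum>k\<in>Poly_Mapping.keys m. Poly_Mapping.lookup m k)"

text \<open>The zero polynomial is homogeneous of every degree.\<close>

definition homogeneous :: "nat \<Rightarrow> 'a::zero mpoly \<Rightarrow> bool"
  where "homogeneous d p \<longleftrightarrow> (\<forall>m\<in>Poly_Mapping.keys p. mdeg m = d)"

text \<open>If \<open>X_j\<close> does not occur in \<open>m\<close>, the truncated exponent is harmless: the coefficient is 0.\<close>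

definition pd :: "nat \<Rightarrow> 'a::comm_ring_1 mpoly \<Rightarrow> 'a mpoly"
  where "pd j p = (\<Sum>m\<in>Poly_Mapping.keys p. Poly_Mapping.single (m - Poly_Mapping.single j 1)
                                  (of_nat (Poly_Mapping.lookup m j) * Poly_Mapping.lookup p m))"

definition M :: "nat \<Rightarrow> nat \<Rightarrow> 'a::comm_ring_1 mpoly \<Rightarrow> 'a mpoly"
  where "M j k p = Var j * pd k p - Var k * pd j p"

text \<open>
  A 2-element subset of \<open>{1..N}\<close> is represented by its elements in increasing order. By
  \<open>M_swap\<close> the square of \<open>M j k\<close> does not depend on that choice.
\<close>

definition MM :: "nat \<Rightarrow> 'a::comm_ring_1 mpoly \<Rightarrow> 'a mpoly"
  where "MM N p = (\<Sum>(j,k)\<in>{(j,k). 1 \<le> j \<and> j < k \<and> k \<le> N}. M j k (M j k p))"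

definition laplacian :: "nat \<Rightarrow> 'a::comm_ring_1 mpoly \<Rightarrow> 'a mpoly"
  where "laplacian N p = (\<Sum>j=1..N. pd j (pd j p))"

text \<open>Eigenvectors, in \<open>R[X_1,...,X_N]\<close>, of an operator on polynomials.\<close>

definition eigenvector :: "nat \<Rightarrow> ('a::comm_ring_1 mpoly \<Rightarrow> 'a mpoly) \<Rightarrow> 'a mpoly \<Rightarrow> bool"
  where "eigenvector N T p \<longleftrightarrow> p \<in> polys {1..N} \<and> p \<noteq> 0 \<and> (\<exists>c. T p = Const c * p)"

definition signs :: "nat \<Rightarrow> (nat \<Rightarrow> int) set"
  where "signs n = {1..n} \<rightarrow> {1, -1}"

text \<open>Tuples are functions of which only the values on \<open>{1..n}\<close> matter.\<close>

definition Y_poly :: "'a::comm_ring_1 \<Rightarrow> nat \<Rightarrow> (nat \<Rightarrow> int) \<Rightarrow> (nat \<Rightarrow> nat) \<Rightarrow> 'a mpoly"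
  where "Y_poly i n \<epsilon> a =
    (\<Prod>j=1..n. (Var (2*j - 1) + Const (i * of_int (\<epsilon> j)) * Var (2*j)) ^ a j)"

text \<open>\<open>R_*[T_1,...,T_n]\<close>: polynomials whose coefficients are themselves polynomials, lying in
  \<open>R_* = R\<close> (constants) if \<open>N = 2n\<close> and in \<open>R_* = R[X_{2n+1}]\<close> otherwise.\<close>

definition R_star :: "nat \<Rightarrow> nat \<Rightarrow> 'a::zero mpoly set"
  where "R_star N n = (if N = 2*n then polys {} else polys {2*n+1})"

definition R_star_polys :: "nat \<Rightarrow> nat \<Rightarrow> 'a::zero mpoly mpoly set"
  where "R_star_polys N n = {q \<in> polys {1..n}. \<forall>m. Poly_Mapping.lookup q m \<in> R_star N n}"

definition eval_poly :: "(nat \<Rightarrow> 'b::comm_semiring_1) \<Rightarrow> 'b mpoly \<Rightarrow> 'b"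
  where "eval_poly f q = (\<Sum>m\<in>Poly_Mapping.keys q. Poly_Mapping.lookup q m * (\<Prod>k\<in>Poly_Mapping.keys m. f k ^ Poly_Mapping.lookup m k))"

text \<open>\<open>q(X_1^2+X_2^2, ..., X_{2n-1}^2+X_{2n}^2)\<close>\<close>

definition at_radii :: "'a::comm_ring_1 mpoly mpoly \<Rightarrow> 'a mpoly"
  where "at_radii q = eval_poly (\<lambda>k. Var (2*k - 1) ^ 2 + Var (2*k) ^ 2) q"

lemma pd_uminus: "pd j (- p) = - pd j p"
  by (simp add: pd_def single_uminus sum_negf)

lemma M_swap: "M k j p = - M j k p" "M k j (M k j p) = M j k (M j k p)"
proof -
  show *: "M k j p = - M j k p" for p :: "'a mpoly"
    by (simp add: M_def)
  have "M k j (M k j p) = - M j k (- M j k p)"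
    using * by metis
  also have "\<dots> = M j k (M j k p)"
    by (simp add: M_def[of j k "- M j k p"] M_def[of j k "M j k p"] pd_uminus)
  finally show "M k j (M k j p) = M j k (M j k p)" .
qed

end

theory Submission
  imports Defs
begin

text \<open>
  With \<open>u_j = X_{2j-1} + i X_{2j}\<close> and \<open>v_j = X_{2j-1} - i X_{2j}\<close>, the operator
  \<open>M_{2j-1,2j}\<close> is the derivation \<open>i (u_j \<partial>/\<partial>u_j - v_j \<partial>/\<partial>v_j)\<close>, so it multiplies a monomial in the
  \<open>u\<close> and \<open>v\<close> by \<open>i\<close> times the difference of its exponents of \<open>u_j\<close> and \<open>v_j\<close>. All monomials of
  a joint eigenvector therefore share these differences, and what remains of each of them is a
  monomial in the products \<open>u_j v_j = X_{2j-1}^2 + X_{2j}^2\<close>. For the last part, with \<open>E\<close> the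
  Euler operator, \<open>M \<cdot> M = |X|^2 \<Delta> - E^2 - (N - 2) E\<close>, and \<open>Y\<close> is harmonic and homogeneous.
\<close>

section \<open>Constants and the decomposition of polynomials into terms\<close>

lemma Const_simps [simp]:
  "Const 0 = 0" "Const 1 = 1" "Const (a + b) = Const a + Const b"
  "Const (- a) = - Const a" "Const (a - b) = Const a - Const b"
  for a b :: "'a::comm_ring_1"
  by (simp_all add: Const_def single_add single_uminus single_diff)

lemma Const_mult [simp]: "Const (a * b) = Const a * Const b" for a b :: "'a::comm_ring_1"
  by (simp add: Const_def mult_single)

lemma Const_of_nat [simp]: "Const (of_nat n) = (of_nat n :: 'a::comm_ring_1 mpoly)"
  by (simp add: Const_def)

lemma Const_of_int [simp]: "Const (of_int n) = (of_int n :: 'a::comm_ring_1 mpoly)"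
  by (simp add: Const_def)

lemma Const_sum: "Const (\<Sum>x\<in>A. g x) = (\<Sum>x\<in>A. Const (g x))" for g :: "'b \<Rightarrow> 'a::comm_ring_1"
  by (induction A rule: infinite_finite_induct) simp_all

lemma single_eq_Const_mult: "Poly_Mapping.single m c = Const c * Poly_Mapping.single m 1"
  for c :: "'a::comm_ring_1"
  by (simp add: Const_def mult_single)

lemma lookup_Const_mult [simp]:
  "Poly_Mapping.lookup (Const c * p) m = c * Poly_Mapping.lookup p m" for c :: "'a::comm_ring_1"
proof -
  have "Const c * p = Poly_Mapping.map ((*) c) p"
    by (simp add: Const_def mult_map_scale_conv_mult)
  then show ?thesis
    by (simp add: Poly_Mapping.map.rep_eq when_def)
qed

lemma poly_mapping_sum_single:
  "p = (\<Sum>m\<in>Poly_Mapping.keys p. Poly_Mapping.single m (Poly_Mapping.lookup p m))"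
proof (rule poly_mapping_eqI)
  fix m
  show "Poly_Mapping.lookup p m = Poly_Mapping.lookup
    (\<Sum>m\<in>Poly_Mapping.keys p. Poly_Mapping.single m (Poly_Mapping.lookup p m)) m"
    by (simp add: lookup_sum lookup_single when_def in_keys_iff)
qed

text \<open>A polynomial is the sum of its terms, so an identity additive in each argument needs
  checking on single terms only. The multiplicativity of \<open>subst\<close> and the product rule
  are proved this way.\<close>

lemma mpoly_additive_induct [case_names zero single add]:
  fixes p :: "'a::comm_ring_1 mpoly"
  assumes "P 0" "\<And>m c. P (Poly_Mapping.single m c)" "\<And>p q. P p \<Longrightarrow> P q \<Longrightarrow> P (p + q)"
  shows "P p"
proof -
  have "P (\<Sum>m\<in>A. Poly_Mapping.single m (Poly_Mapping.lookup p m))" for A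
    by (induction A rule: infinite_finite_induct) (use assms in auto)
  then show ?thesis
    using poly_mapping_sum_single[of p] by metis
qed

subsection \<open>Substitution\<close>

definition monval :: "(nat \<Rightarrow> 'b::comm_semiring_1) \<Rightarrow> (nat \<Rightarrow>\<^sub>0 nat) \<Rightarrow> 'b"
  where "monval f m = (\<Prod>k\<in>Poly_Mapping.keys m. f k ^ Poly_Mapping.lookup m k)"

lemma monval_superset:
  assumes "finite A" "Poly_Mapping.keys m \<subseteq> A"
  shows "monval f m = (\<Prod>k\<in>A. f k ^ Poly_Mapping.lookup m k)"
  unfolding monval_def
  by (rule prod.mono_neutral_left) (use assms in \<open>auto simp: in_keys_iff\<close>)

lemma monval_add: "monval f (m + m') = monval f m * monval f m'"
proof -
  let ?A = "Poly_Mapping.keys m \<union> Poly_Mapping.keys m'"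
  have "Poly_Mapping.keys (m + m') \<subseteq> ?A"
    by (rule keys_add)
  then show ?thesis
    by (simp add: monval_superset[where A = ?A] lookup_add power_add prod.distrib)
qed

lemma monval_0 [simp]: "monval f 0 = 1"
  by (simp add: monval_def)

lemma monval_single [simp]: "monval f (Poly_Mapping.single k n) = f k ^ n"
  by (simp add: monval_def)

text \<open>The endomorphism of the \<open>R\<close>-algebra of polynomials that sends X_k to
  \<open>f k\<close>. Unlike in \<open>eval_poly\<close>, the coefficients lie in \<open>R\<close>
  and are embedded by \<open>Const\<close> before multiplying.\<close>

definition subst :: "(nat \<Rightarrow> 'a::comm_ring_1 mpoly) \<Rightarrow> 'a mpoly \<Rightarrow> 'a mpoly"
  where "subst f p = (\<Sum>m\<in>Poly_Mapping.keys p. Const (Poly_Mapping.lookup p m) * monval f m)"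

lemma subst_add [simp]: "subst f (p + q) = subst f p + subst f q"
  unfolding subst_def
  by (rule setsum_keys_plus_distrib) (simp_all add: algebra_simps)

lemma subst_0 [simp]: "subst f 0 = 0"
  by (simp add: subst_def)

lemma subst_single: "subst f (Poly_Mapping.single m c) = Const c * monval f m"
  by (simp add: subst_def)

lemma subst_Const [simp]: "subst f (Const c) = Const c"
  by (simp add: Const_def subst_single)

lemma subst_1 [simp]: "subst f 1 = 1"
  using subst_Const[of f 1] by simp

lemma subst_Var [simp]: "subst f (Var k) = f k"
  by (simp add: Var_def subst_single)

lemma subst_mult [simp]: "subst f (p * q) = subst f p * subst f q"
proof (induction p rule: mpoly_additive_induct)
  case (single m c)
  show ?case
  proof (induction q rule: mpoly_additive_induct)
    case (single m' c')
    show ?case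
      by (simp add: mult_single subst_single monval_add ac_simps)
  qed (simp_all add: algebra_simps)
qed (simp_all add: algebra_simps)

lemma subst_minus [simp]: "subst f (p - q) = subst f p - subst f q"
  using subst_add[of f "p - q" q] by simp

lemma subst_power [simp]: "subst f (p ^ n) = subst f p ^ n"
  by (induction n) simp_all

lemma subst_prod: "subst f (\<Prod>x\<in>A. g x) = (\<Prod>x\<in>A. subst f (g x))"
  by (induction A rule: infinite_finite_induct) simp_all

lemma subst_monval: "subst f (monval g m) = monval (\<lambda>k. subst f (g k)) m"
  by (simp add: monval_def subst_prod)

lemma subst_subst: "subst f (subst g p) = subst (\<lambda>k. subst f (g k)) p"
  by (induction p rule: mpoly_additive_induct) (simp_all add: subst_single subst_monval)

lemma monval_Var: "monval Var m = (Poly_Mapping.single m 1 :: 'a::comm_ring_1 mpoly)"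
proof -
  have pow: "Var k ^ n = (Poly_Mapping.single (Poly_Mapping.single k n) 1 :: 'a mpoly)" for k n
    by (induction n) (simp_all add: Var_def mult_single flip: single_add)
  have "(\<Prod>k\<in>A. Poly_Mapping.single (Poly_Mapping.single k (Poly_Mapping.lookup m k)) 1) =
      (Poly_Mapping.single (\<Sum>k\<in>A. Poly_Mapping.single k (Poly_Mapping.lookup m k)) 1 :: 'a mpoly)" for A
    by (induction A rule: infinite_finite_induct) (simp_all add: mult_single)
  \<comment> \<open>\<open>poly_mapping_sum_single\<close> is applied to the exponent function
    \<open>m\<close> itself, which is the sum of its one-point parts.\<close>
  then show ?thesis
    by (simp add: monval_def pow flip: poly_mapping_sum_single)
qed

lemma subst_Var_id: "subst Var p = p"
  by (induction p rule: mpoly_additive_induct)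
    (simp_all add: subst_single monval_Var flip: single_eq_Const_mult)

subsection \<open>Subrings of polynomials and degrees\<close>

lemma polys_0 [simp]: "0 \<in> polys V"
  by (simp add: polys_def)

lemma polys_add: "p \<in> polys V \<Longrightarrow> q \<in> polys V \<Longrightarrow> p + q \<in> polys V"
  for p q :: "'a::comm_ring_1 mpoly"
  using keys_add[of p q] by (auto simp: polys_def)

lemma polys_Const [simp]: "Const c \<in> polys V"
  by (simp add: polys_def Const_def)

lemma polys_1 [simp]: "(1 :: 'a::comm_ring_1 mpoly) \<in> polys V"
  using polys_Const[of "1::'a"] by simp

lemma polys_Var: "k \<in> V \<Longrightarrow> (Var k :: 'a::comm_ring_1 mpoly) \<in> polys V"
  by (simp add: polys_def Var_def)

lemma polys_mult: "p \<in> polys V \<Longrightarrow> q \<in> polys V \<Longrightarrow> p * q \<in> polys V"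
  for p q :: "'a::comm_ring_1 mpoly"
proof -
  assume *: "p \<in> polys V" "q \<in> polys V"
  have "Poly_Mapping.keys m \<subseteq> V" if m: "m \<in> Poly_Mapping.keys (p * q)" for m
  proof -
    obtain a b where "m = a + b" "a \<in> Poly_Mapping.keys p" "b \<in> Poly_Mapping.keys q"
      using keys_mult[of p q] m by blast
    then show ?thesis
      using * keys_add[of a b] by (fastforce simp: polys_def)
  qed
  then show ?thesis
    by (auto simp: polys_def)
qed

lemma polys_minus: "p \<in> polys V \<Longrightarrow> q \<in> polys V \<Longrightarrow> p - q \<in> polys V"
  for p q :: "'a::comm_ring_1 mpoly"
  using polys_add[of p V "- q"] by (simp add: polys_def)

lemma polys_power: "p \<in> polys V \<Longrightarrow> p ^ n \<in> polys V" for p :: "'a::comm_ring_1 mpoly"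
  by (induction n) (simp_all add: polys_mult)

lemma polys_prod: "(\<And>x. x \<in> A \<Longrightarrow> g x \<in> polys V) \<Longrightarrow> (\<Prod>x\<in>A. g x) \<in> polys V"
  for g :: "'b \<Rightarrow> 'a::comm_ring_1 mpoly"
  by (induction A rule: infinite_finite_induct) (simp_all add: polys_mult)

lemma polys_sum: "(\<And>x. x \<in> A \<Longrightarrow> g x \<in> polys V) \<Longrightarrow> (\<Sum>x\<in>A. g x) \<in> polys V"
  for g :: "'b \<Rightarrow> 'a::comm_ring_1 mpoly"
  by (induction A rule: infinite_finite_induct) (simp_all add: polys_add)

lemma subst_in_polys:
  assumes "p \<in> polys V" "\<And>k. k \<in> V \<Longrightarrow> f k \<in> polys W"
  shows "subst f p \<in> polys W"
  unfolding subst_def monval_def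
proof (intro polys_sum polys_mult polys_Const polys_prod polys_power)
  fix m k assume "m \<in> Poly_Mapping.keys p" "k \<in> Poly_Mapping.keys m"
  then show "f k \<in> polys W"
    using assms unfolding polys_def by blast
qed

section \<open>Degrees and homogeneous polynomials\<close>

lemma mdeg_superset:
  assumes "finite A" "Poly_Mapping.keys m \<subseteq> A"
  shows "mdeg m = (\<Sum>k\<in>A. Poly_Mapping.lookup m k)"
  unfolding mdeg_def
  by (rule sum.mono_neutral_left) (use assms in \<open>auto simp: in_keys_iff\<close>)

lemma mdeg_add: "mdeg (m + m') = mdeg m + mdeg m'"
proof -
  let ?A = "Poly_Mapping.keys m \<union> Poly_Mapping.keys m'"
  have "Poly_Mapping.keys (m + m') \<subseteq> ?A"
    by (rule keys_add)
  then show ?thesis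
    by (simp add: mdeg_superset[where A = ?A] lookup_add sum.distrib)
qed

lemma mdeg_eq_0_iff [simp]: "mdeg m = 0 \<longleftrightarrow> m = 0"
proof
  assume "mdeg m = 0"
  then show "m = 0"
    by (intro poly_mapping_eqI) (auto simp: mdeg_def in_keys_iff)
qed (simp add: mdeg_def)

lemma homogeneous_add: "homogeneous d p \<Longrightarrow> homogeneous d q \<Longrightarrow> homogeneous d (p + q)"
  for p q :: "'a::comm_ring_1 mpoly"
  using keys_add[of p q] by (auto simp: homogeneous_def)

lemma homogeneous_minus: "homogeneous d p \<Longrightarrow> homogeneous d q \<Longrightarrow> homogeneous d (p - q)"
  for p q :: "'a::comm_ring_1 mpoly"
  using homogeneous_add[of d p "- q"] by (simp add: homogeneous_def)

lemma homogeneous_mult: "homogeneous d p \<Longrightarrow> homogeneous e q \<Longrightarrow> homogeneous (d + e) (p * q)"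
  for p q :: "'a::comm_ring_1 mpoly"
  using keys_mult[of p q] by (fastforce simp: homogeneous_def mdeg_add)

lemma homogeneous_Const [simp]: "homogeneous 0 (Const c)"
  by (simp add: homogeneous_def Const_def)

lemma homogeneous_1 [simp]: "homogeneous 0 (1 :: 'a::comm_ring_1 mpoly)"
  using homogeneous_Const[of "1::'a"] by simp

lemma homogeneous_Var [simp]: "homogeneous 1 (Var k :: 'a::comm_ring_1 mpoly)"
  by (simp add: homogeneous_def Var_def mdeg_def)

lemma homogeneous_power: "homogeneous d p \<Longrightarrow> homogeneous (n * d) (p ^ n)"
  for p :: "'a::comm_ring_1 mpoly"
  by (induction n) (simp_all add: homogeneous_mult)

lemma homogeneous_prod:
  "(\<And>x. x \<in> A \<Longrightarrow> homogeneous (d x) (g x)) \<Longrightarrow> homogeneous (\<Sum>x\<in>A. d x) (\<Prod>x\<in>A. g x)"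
  for g :: "'b \<Rightarrow> 'a::comm_ring_1 mpoly"
  by (induction A rule: infinite_finite_induct) (simp_all add: homogeneous_mult)

text \<open>Compare components of degree \<open>d\<close>: only the constant term of \<open>P\<close> contributes.\<close>

lemma homogeneous_factor:
  fixes Y P :: "'a::comm_ring_1 mpoly"
  assumes Y: "homogeneous d Y" and YP: "homogeneous d (Y * P)"
  shows "Y * P = Const (Poly_Mapping.lookup P 0) * Y"
proof -
  define c where "c = Poly_Mapping.lookup P 0"
  define Q where "Q = P - Const c"
  have Q: "mdeg m \<noteq> 0" if "m \<in> Poly_Mapping.keys Q" for m
    using that by (auto simp: Q_def c_def in_keys_iff lookup_minus Const_def)
  have "homogeneous (0 + d) (Const c * Y)"
    using Y by (intro homogeneous_mult) auto
  then have "homogeneous d (Y * P - Const c * Y)"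
    using YP by (simp add: homogeneous_minus)
  moreover have "Y * P - Const c * Y = Y * Q"
    by (simp add: Q_def algebra_simps)
  ultimately have "homogeneous d (Y * Q)"
    by simp
  \<comment> \<open>\<open>Q\<close> has no constant term, so every monomial of \<open>Y * Q\<close>
    has degree above \<open>d\<close>; homogeneity of degree \<open>d\<close> then leaves no
    monomial at all.\<close>
  moreover have "mdeg m \<noteq> d" if m: "m \<in> Poly_Mapping.keys (Y * Q)" for m
  proof -
    obtain a b where "m = a + b" "a \<in> Poly_Mapping.keys Y" "b \<in> Poly_Mapping.keys Q"
      using keys_mult[of Y Q] m by blast
    then show ?thesis
      using Y Q by (auto simp: homogeneous_def mdeg_add)
  qed
  ultimately have "Poly_Mapping.keys (Y * Q) = {}"
    by (auto simp: homogeneous_def)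
  then have "Y * Q = 0"
    by (simp add: poly_mapping_eq_iff fun_eq_iff in_keys_iff set_eq_iff)
  then show ?thesis
    by (simp add: Q_def c_def algebra_simps)
qed

subsection \<open>Derivations\<close>

text \<open>\<open>M j k\<close>, \<open>euler N\<close> and combinations of partial derivatives all
  fall under this notion. Vanishing on constants, with the product rule, makes them
  \<open>R\<close>-linear.\<close>

definition derivation :: "('a::comm_ring_1 mpoly \<Rightarrow> 'a mpoly) \<Rightarrow> bool"
  where "derivation D \<longleftrightarrow> (\<forall>p q. D (p + q) = D p + D q) \<and>
    (\<forall>p q. D (p * q) = D p * q + p * D q) \<and> (\<forall>c. D (Const c) = 0)"

lemma derivationD:
  assumes "derivation D"
  shows "D (p + q) = D p + D q" "D (p * q) = D p * q + p * D q" "D (Const c) = 0"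
    "D 0 = 0" "D 1 = 0" "D (Const c * p) = Const c * D p"
proof -
  have *: "D (p + q) = D p + D q" "D (p * q) = D p * q + p * D q" "D (Const c) = 0" for p q c
    using assms by (auto simp: derivation_def)
  show "D (p + q) = D p + D q" "D (p * q) = D p * q + p * D q" "D (Const c) = 0"
    using * by auto
  show "D 0 = 0" "D 1 = 0"
    using *(3)[of 0] *(3)[of 1] by simp_all
  show "D (Const c * p) = Const c * D p"
    using * by simp
qed

lemma derivation_sum:
  assumes "derivation D"
  shows "D (\<Sum>x\<in>A. g x) = (\<Sum>x\<in>A. D (g x))"
  by (induction A rule: infinite_finite_induct) (use assms in \<open>simp_all add: derivationD\<close>)

text \<open>Logarithmic derivatives add up: the eigenvalues of the factors, weighted by the
  exponents, sum to that of the product. This serves both for \<open>Y_poly\<close> and for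
  monomials in the u and v.\<close>

lemma derivation_prod_eigen:
  assumes D: "derivation D"
    and "\<And>k. k \<in> A \<Longrightarrow> D (f k) = Const (e k) * f k"
  shows "D (\<Prod>k\<in>A. f k ^ a k) = Const (\<Sum>k\<in>A. e k * of_nat (a k)) * (\<Prod>k\<in>A. f k ^ a k)"
proof -
  have pow: "D (f k ^ n) = Const (e k * of_nat n) * f k ^ n" if "k \<in> A" for k n
    by (induction n) (use assms(2)[OF that] in \<open>simp_all add: derivationD[OF D] algebra_simps\<close>)
  show ?thesis
    using pow
    by (induction A rule: infinite_finite_induct) (simp_all add: derivationD[OF D] algebra_simps)
qed

lemma derivation_mult_left: "derivation D \<Longrightarrow> derivation (\<lambda>p. g * D p)"
  by (simp add: derivation_def algebra_simps)

lemma derivation_diff: "derivation D \<Longrightarrow> derivation D' \<Longrightarrow> derivation (\<lambda>p. D p - D' p)"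
  by (simp add: derivation_def algebra_simps)

lemma derivation_sum_fun:
  "(\<And>x. x \<in> A \<Longrightarrow> derivation (D x)) \<Longrightarrow> derivation (\<lambda>p. \<Sum>x\<in>A. D x p)"
  by (simp add: derivation_def sum.distrib sum_distrib_left sum_distrib_right)

section \<open>Partial derivatives as commuting derivations\<close>

lemma pd_add: "pd j (p + q) = pd j p + pd j q"
  unfolding pd_def
  by (rule setsum_keys_plus_distrib) (simp_all add: algebra_simps single_add)

lemma pd_0 [simp]: "pd j 0 = 0"
  by (simp add: pd_def)

lemma pd_single:
  "pd j (Poly_Mapping.single m c) =
    Poly_Mapping.single (m - Poly_Mapping.single j 1) (of_nat (Poly_Mapping.lookup m j) * c)"
  by (simp add: pd_def)

lemma single_minus_single_add:
  assumes "Poly_Mapping.lookup m j \<noteq> 0"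
  shows "m - Poly_Mapping.single j 1 + m' = m + m' - Poly_Mapping.single j (1::nat)"
  by (rule poly_mapping_eqI) (use assms in \<open>auto simp: lookup_add lookup_minus lookup_single when_def\<close>)

lemma pd_mult: "pd j (p * q) = pd j p * q + p * pd j q"
proof (induction p rule: mpoly_additive_induct)
  case (single m c)
  show ?case
  proof (induction q rule: mpoly_additive_induct)
    case (single m' c')
    \<comment> \<open>The truncated subtraction may be moved past the other exponent if X_j occurs
      in the monomial being differentiated; otherwise the coefficient \<open>of_nat 0\<close> makes
      both sides vanish.\<close>
    have 1: "Poly_Mapping.single (m - Poly_Mapping.single j 1 + m') (of_nat (Poly_Mapping.lookup m j) * c * c') =
       Poly_Mapping.single (m + m' - Poly_Mapping.single j 1) (of_nat (Poly_Mapping.lookup m j) * c * c')"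
      using single_minus_single_add[of m j m']
      by (cases "Poly_Mapping.lookup m j = 0") simp_all
    have 2: "Poly_Mapping.single (m + (m' - Poly_Mapping.single j 1)) (c * (of_nat (Poly_Mapping.lookup m' j) * c')) =
       Poly_Mapping.single (m + m' - Poly_Mapping.single j 1) (c * (of_nat (Poly_Mapping.lookup m' j) * c'))"
      using single_minus_single_add[of m' j m]
      by (cases "Poly_Mapping.lookup m' j = 0") (simp_all add: add.commute)
    show ?case
      unfolding mult_single pd_single 1 2
      by (simp add: lookup_add algebra_simps flip: single_add)
  qed (simp_all add: algebra_simps pd_add)
qed (simp_all add: algebra_simps pd_add)

lemma pd_Const [simp]: "pd j (Const c) = 0"
  by (simp add: Const_def pd_single)

lemma pd_Var: "pd j (Var k) = (if j = k then 1 else 0)"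
  by (simp add: Var_def pd_single lookup_single)

lemma derivation_pd: "derivation (pd j)"
  by (simp add: derivation_def pd_add pd_mult)

lemma derivation_M: "derivation (M j k)"
  unfolding M_def[abs_def]
  by (intro derivation_diff derivation_mult_left derivation_pd)

lemma pd_diff: "pd j (p - q) = pd j p - pd j q"
  using pd_add[of j "p - q" q] by simp

lemma pd_commute: "pd j (pd k p) = pd k (pd j p)"
proof (induction p rule: mpoly_additive_induct)
  case (single m c)
  show ?case
    by (cases "j = k")
      (simp_all add: pd_single lookup_minus lookup_single diff_diff_eq add.commute mult.left_commute)
qed (simp_all add: pd_add)

subsection \<open>The Euler operator and the Laplacian\<close>

definition euler :: "nat \<Rightarrow> 'a::comm_ring_1 mpoly \<Rightarrow> 'a mpoly"
  where "euler N p = (\<Sum>k=1..N. Var k * pd k p)"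

lemma derivation_euler: "derivation (euler N)"
  unfolding euler_def[abs_def]
  by (intro derivation_sum_fun derivation_mult_left derivation_pd)

lemma euler_Var: "k \<in> {1..N} \<Longrightarrow> euler N (Var k) = Var k"
  by (simp add: euler_def pd_Var if_distrib cong: if_cong)

text \<open>Differentiating the coefficients X_k of the outer expression yields the first-order
  term. Read backwards, the formula expresses the mixed derivatives in M.M by the Euler
  operator.\<close>

lemma euler_euler:
  "euler N (euler N p) = euler N p + (\<Sum>j=1..N. \<Sum>k=1..N. Var j * Var k * pd j (pd k p))"
proof -
  have "pd j (euler N p) = pd j p + (\<Sum>k=1..N. Var k * pd j (pd k p))" if "j \<in> {1..N}" for j
    using that
    by (simp add: euler_def derivation_sum[OF derivation_pd] pd_mult pd_Var sum.distrib
        if_distrib[of "\<lambda>x. x * _"] cong: if_cong)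
  then have "euler N (euler N p) =
      (\<Sum>j=1..N. Var j * (pd j p + (\<Sum>k=1..N. Var k * pd j (pd k p))))"
    by (simp add: euler_def[of N "euler N p"])
  also have "\<dots> = euler N p + (\<Sum>j=1..N. \<Sum>k=1..N. Var j * Var k * pd j (pd k p))"
    by (simp add: euler_def algebra_simps sum.distrib sum_distrib_left)
  finally show ?thesis .
qed

text \<open>The last summand corrects the diagonal, where \<open>M j j\<close> is zero, so that the
  formula can be summed over all ordered pairs.\<close>

lemma M_M_expand:
  "M j k (M j k p) =
     Var j ^ 2 * pd k (pd k p) + Var k ^ 2 * pd j (pd j p) - 2 * (Var j * Var k * pd j (pd k p))
     - Var j * pd j p - Var k * pd k p + (if j = k then 2 * (Var j * pd j p) else 0)"
proof (cases "j = k")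
  case False
  have *: "pd k (M j k p) = Var j * pd k (pd k p) - pd j p - Var k * pd k (pd j p)"
    "pd j (M j k p) = pd k p + Var j * pd j (pd k p) - Var k * pd j (pd j p)"
    using False by (simp_all add: M_def pd_diff pd_mult pd_Var algebra_simps)
  then show ?thesis
    unfolding M_def[of j k "M j k p"] *
    using False by (simp add: pd_commute[of k j] power2_eq_square algebra_simps)
qed (simp add: M_def power2_eq_square)

text \<open>By \<open>M_swap\<close> the pairs below the diagonal repeat those above it, and the
  diagonal contributes nothing. Sums over the full square split into products, at the price of the
  factor 2.\<close>

lemma two_MM: "2 * MM N p = (\<Sum>j=1..N. \<Sum>k=1..N. M j k (M j k p))"
proof -
  let ?f = "\<lambda>(j, k). M j k (M j k p)"
  let ?L = "{(j, k). 1 \<le> j \<and> j < k \<and> k \<le> N}"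
  let ?G = "{(j, k). 1 \<le> k \<and> k < j \<and> j \<le> N}"
  have fin: "finite ?L" "finite ?G"
    by (rule finite_subset[of _ "{1..N} \<times> {1..N}"]; force)+
  have G: "sum ?f ?G = sum ?f ?L"
    by (rule sum.reindex_bij_witness[of _ prod.swap prod.swap]) (auto simp: M_swap(2))
  have "(\<Sum>j=1..N. \<Sum>k=1..N. M j k (M j k p)) = sum ?f ({1..N} \<times> {1..N})"
    by (simp add: sum.cartesian_product)
  also have "\<dots> = sum ?f (?L \<union> ?G)"
    by (rule sum.mono_neutral_right) (force simp: M_def not_less_iff_gr_or_eq)+
  also have "\<dots> = sum ?f ?L + sum ?f ?G"
    using fin by (intro sum.union_disjoint) auto
  finally show ?thesis
    unfolding G by (simp add: MM_def)
qed

text \<open>Origin of \<open>N - 2\<close>: the two first-order sums each give -N E, while the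
  diagonal correction and the mixed derivatives each give back 2 E. The factor 2 stays because it
  cannot be cancelled in a general ring.\<close>

lemma two_MM_eq:
  "2 * MM N p = 2 * ((\<Sum>j=1..N. Var j ^ 2) * laplacian N p - euler N (euler N p)
     - (of_nat N - 2) * euler N p)"
proof -
  have 1: "(\<Sum>j=1..N. \<Sum>k=1..N. Var j ^ 2 * pd k (pd k p)) = (\<Sum>j=1..N. Var j ^ 2) * laplacian N p"
    by (simp add: laplacian_def sum_product)
  have 2: "(\<Sum>j=1..N. \<Sum>k=1..N. Var k ^ 2 * pd j (pd j p)) = (\<Sum>j=1..N. Var j ^ 2) * laplacian N p"
    by (subst sum.swap) (rule 1)
  have 3: "(\<Sum>j=1..N. \<Sum>k=1..N. Var j * pd j p) = of_nat N * euler N p"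
    by (simp add: euler_def sum_distrib_left)
  have 4: "(\<Sum>j=1..N. \<Sum>k=1..N. Var k * pd k p) = of_nat N * euler N p"
    by (simp add: euler_def)
  have 5: "(\<Sum>j=1..N. \<Sum>k=1..N. if j = k then 2 * (Var j * pd j p) else 0) = 2 * euler N p"
    by (simp add: euler_def sum_distrib_left)
  have 6: "(\<Sum>j=1..N. \<Sum>k=1..N. 2 * (Var j * Var k * pd j (pd k p)))
      = 2 * (euler N (euler N p) - euler N p)"
    by (simp add: euler_euler sum_distrib_left)
  show ?thesis
    unfolding two_MM M_M_expand sum.distrib sum_subtractf 1 2 3 4 5 6
    by (simp add: algebra_simps)
qed

subsection \<open>The polynomials \<open>Y\<close>\<close>

text \<open>u_j and v_j are the cases of sign 1 and -1.\<close>

definition lin :: "'a::comm_ring_1 \<Rightarrow> (nat \<Rightarrow> int) \<Rightarrow> nat \<Rightarrow> 'a mpoly"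
  where "lin i \<epsilon> j = Var (2 * j - 1) + Const (i * of_int (\<epsilon> j)) * Var (2 * j)"

lemma Y_poly_lin: "Y_poly i n \<epsilon> a = (\<Prod>j=1..n. lin i \<epsilon> j ^ a j)"
  by (simp add: Y_poly_def lin_def)

lemma odd_eq_odd_iff: "j \<ge> 1 \<Longrightarrow> k \<ge> 1 \<Longrightarrow> 2 * j - 1 = 2 * k - 1 \<longleftrightarrow> j = k" for j k :: nat
  by auto

lemma odd_neq_even: "j \<ge> 1 \<Longrightarrow> 2 * j - 1 \<noteq> 2 * k" "j \<ge> 1 \<Longrightarrow> 2 * k \<noteq> 2 * j - 1" for j k :: nat
  by presburger+

lemma pd_lin:
  assumes "k \<ge> 1"
  shows "pd l (lin i \<epsilon> k) = (if l = 2 * k - 1 then 1 else if l = 2 * k then Const (i * of_int (\<epsilon> k)) else 0)"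
  using assms odd_neq_even[of k k] unfolding lin_def
  by (simp add: pd_add pd_mult pd_Var del: Const_mult Const_of_int)

lemma sign_square: "\<epsilon> \<in> signs n \<Longrightarrow> k \<in> {1..n} \<Longrightarrow> \<epsilon> k * \<epsilon> k = 1"
  by (force simp: signs_def)

lemma sign_i_square:
  assumes "i\<^sup>2 = (-1 :: 'a::comm_ring_1)" "\<epsilon> \<in> signs n" "k \<in> {1..n}"
  shows "Const (i * of_int (\<epsilon> k)) * Const (i * of_int (\<epsilon> k)) = -1"
proof -
  have "(i * of_int (\<epsilon> k)) * (i * of_int (\<epsilon> k)) = (i * i) * of_int (\<epsilon> k * \<epsilon> k)"
    by (simp add: ac_simps)
  also have "\<dots> = -1"
    using assms(1) sign_square[OF assms(2,3)] by (simp add: power2_eq_square)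
  finally have "Const ((i * of_int (\<epsilon> k)) * (i * of_int (\<epsilon> k))) = Const (-1)"
    by simp
  then show ?thesis
    by (metis Const_mult Const_simps(2,4))
qed

text \<open>On a pair x, y the operator sends x to -y and y to x. Hence x + c y goes to c x - y,
  which is c (x + c y) because c^2 = -1 for c = i \<epsilon>_k. Factors of other pairs contain
  neither variable.\<close>

lemma M_lin:
  assumes "i\<^sup>2 = (-1 :: 'a::comm_ring_1)" "\<epsilon> \<in> signs n" "k \<in> {1..n}" "j \<in> {1..n}"
  shows "M (2 * j - 1) (2 * j) (lin i \<epsilon> k)
    = Const (if k = j then i * of_int (\<epsilon> k) else 0) * lin i \<epsilon> k"
proof (cases "k = j")
  case True
  let ?c = "Const (i * of_int (\<epsilon> k))"
  have "?c * lin i \<epsilon> k = ?c * Var (2 * k - 1) + (?c * ?c) * Var (2 * k)"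
    by (simp add: lin_def algebra_simps)
  also have "\<dots> = ?c * Var (2 * k - 1) - Var (2 * k)"
    using sign_i_square[OF assms(1-3)] by simp
  also have "\<dots> = M (2 * j - 1) (2 * j) (lin i \<epsilon> k)"
    using True assms(3) odd_neq_even[of k k] by (simp add: M_def pd_lin mult.commute)
  finally show ?thesis
    using True by simp
next
  case False
  then show ?thesis
    using assms(3,4) odd_neq_even[of j k] odd_neq_even[of k j] odd_eq_odd_iff[of j k]
    by (simp add: M_def pd_lin)
qed

lemma M_Y_poly:
  assumes "i\<^sup>2 = (-1 :: 'a::comm_ring_1)" "\<epsilon> \<in> signs n" "j \<in> {1..n}"
  shows "M (2 * j - 1) (2 * j) (Y_poly i n \<epsilon> a)
    = Const (i * of_int (\<epsilon> j) * of_nat (a j)) * Y_poly i n \<epsilon> a"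
proof -
  have "(\<Sum>k=1..n. (if k = j then i * of_int (\<epsilon> k) else 0) * of_nat (a k))
      = (\<Sum>k=1..n. if k = j then i * of_int (\<epsilon> k) * of_nat (a k) else 0)"
    by (rule sum.cong) auto
  also have "\<dots> = i * of_int (\<epsilon> j) * of_nat (a j)"
    using assms(3) by simp
  finally show ?thesis
    using derivation_prod_eigen[OF derivation_M, of "{1..n}" "2 * j - 1" "2 * j" "lin i \<epsilon>" _ a,
        OF M_lin[OF assms(1,2) _ assms(3)]]
    by (simp only: Y_poly_lin)
qed

lemma euler_Y_poly:
  assumes "2 * n \<le> N"
  shows "euler N (Y_poly i n \<epsilon> a) = of_nat (\<Sum>j=1..n. a j) * Y_poly i n \<epsilon> a"
proof -
  have "euler N (lin i \<epsilon> k) = Const 1 * lin i \<epsilon> k" if "k \<in> {1..n}" for k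
  proof -
    have "2 * k - 1 \<in> {1..N}" "2 * k \<in> {1..N}"
      using that assms by auto
    then show ?thesis
      unfolding lin_def by (simp only: derivationD[OF derivation_euler] euler_Var) simp
  qed
  from derivation_prod_eigen[OF derivation_euler, of "{1..n}" N "lin i \<epsilon>" "\<lambda>_. 1" a, OF this]
  show ?thesis
    by (simp add: Y_poly_lin Const_sum)
qed

lemma homogeneous_Y_poly: "homogeneous (\<Sum>j=1..n. a j) (Y_poly i n \<epsilon> a)"
proof -
  have "homogeneous (0 + 1) (Const (i * of_int (\<epsilon> j)) * Var (2 * j))" for j
    by (intro homogeneous_mult homogeneous_Const homogeneous_Var)
  then have "homogeneous 1 (lin i \<epsilon> j)" for j
    unfolding lin_def by (intro homogeneous_add homogeneous_Var) simp
  then have "homogeneous (a j * 1) (lin i \<epsilon> j ^ a j)" for j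
    by (rule homogeneous_power)
  then show ?thesis
    unfolding Y_poly_lin by (intro homogeneous_prod) simp
qed

lemma Y_poly_in_polys: "2 * n \<le> N \<Longrightarrow> Y_poly i n \<epsilon> a \<in> polys {1..N}"
  unfolding Y_poly_def
  by (intro polys_prod polys_power polys_add polys_mult polys_Const polys_Var) auto

text \<open>As \<open>R\<close> may have zero divisors, nonzero factors would not suffice. Putting 1
  for the odd and 0 for the even variables sends every factor to 1.\<close>

lemma Y_poly_nonzero: "Y_poly i n \<epsilon> a \<noteq> 0"
proof
  let ?f = "\<lambda>k. if odd k then 1 else 0 :: 'a mpoly"
  assume "Y_poly i n \<epsilon> a = 0"
  then have "subst ?f (Y_poly i n \<epsilon> a) = 0"
    by simp
  moreover have "subst ?f (Y_poly i n \<epsilon> a) = 1"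
    by (simp add: Y_poly_def subst_prod)
  ultimately show False
    by simp
qed

text \<open>A Cauchy-Riemann argument: with c = i \<epsilon>_j, the derivation \<open>?D\<close>
  kills every linear factor and hence \<open>Y_poly\<close>. So the derivative along X_{2j} is c
  times that along X_{2j-1}, and c^2 = -1 cancels the second derivatives.\<close>

lemma pd_2_Y_poly:
  assumes "i\<^sup>2 = (-1 :: 'a::comm_ring_1)" "\<epsilon> \<in> signs n" "j \<in> {1..n}"
  shows "pd (2 * j - 1) (pd (2 * j - 1) (Y_poly i n \<epsilon> a)) + pd (2 * j) (pd (2 * j) (Y_poly i n \<epsilon> a)) = 0"
proof -
  let ?c = "Const (i * of_int (\<epsilon> j))" and ?Y = "Y_poly i n \<epsilon> a"
  let ?D = "\<lambda>p. pd (2 * j) p - ?c * pd (2 * j - 1) p"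
  have "derivation ?D"
    by (intro derivation_diff derivation_mult_left derivation_pd)
  moreover have "?D (lin i \<epsilon> k) = Const 0 * lin i \<epsilon> k" if "k \<in> {1..n}" for k
    using assms(3) that odd_neq_even[of j k] odd_neq_even[of k j] odd_neq_even[of j j] odd_eq_odd_iff[of j k]
    by (cases "k = j") (simp_all add: pd_lin)
  ultimately have "?D ?Y = Const (\<Sum>k=1..n. 0 * of_nat (a k)) * ?Y"
    unfolding Y_poly_lin by (rule derivation_prod_eigen)
  then have 1: "pd (2 * j) ?Y = ?c * pd (2 * j - 1) ?Y"
    by simp
  have "pd (2 * j) (pd (2 * j) ?Y) = ?c * pd (2 * j - 1) (pd (2 * j) ?Y)"
    by (subst 1) (simp only: derivationD(6)[OF derivation_pd] pd_commute[of "2 * j"])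
  also have "\<dots> = (?c * ?c) * pd (2 * j - 1) (pd (2 * j - 1) ?Y)"
    unfolding 1 by (simp only: derivationD(6)[OF derivation_pd] mult.assoc)
  finally show ?thesis
    using sign_i_square[OF assms] by simp
qed

lemma sum_pairs: "(\<Sum>k=1..2*n. g k) = (\<Sum>j=1..n. g (2 * j - 1) + g (2 * j))"
  for g :: "nat \<Rightarrow> 'b::comm_monoid_add"
  by (induction n) (simp_all add: ac_simps)

lemma prod_pairs: "(\<Prod>k=1..2*n. g k) = (\<Prod>j=1..n. g (2 * j - 1) * g (2 * j))"
  for g :: "nat \<Rightarrow> 'b::comm_monoid_mult"
  by (induction n) (simp_all add: ac_simps)

lemma laplacian_Y_poly:
  assumes "i\<^sup>2 = (-1 :: 'a::comm_ring_1)" "\<epsilon> \<in> signs n" "N = 2 * n \<or> N = 2 * n + 1"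
  shows "laplacian N (Y_poly i n \<epsilon> a) = 0"
proof -
  have "laplacian (2 * n) (Y_poly i n \<epsilon> a) = 0"
    unfolding laplacian_def sum_pairs by (rule sum.neutral) (use pd_2_Y_poly[OF assms(1,2)] in blast)
  \<comment> \<open>For odd \<open>N\<close> one variable lies outside all pairs; it does not occur
    in \<open>Y_poly\<close>.\<close>
  moreover have "pd (2 * n + 1) (Y_poly i n \<epsilon> a) = 0"
  proof -
    have "pd (2 * n + 1) (lin i \<epsilon> k) = Const 0 * lin i \<epsilon> k" if "k \<in> {1..n}" for k
      using that by (auto simp: pd_lin)
    from derivation_prod_eigen[OF derivation_pd, of "{1..n}" _ "lin i \<epsilon>" "\<lambda>_. 0" a, OF this]
    show ?thesis
      by (simp add: Y_poly_lin)
  qed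
  ultimately show ?thesis
    using assms(3) by (auto simp: laplacian_def)
qed

text \<open>Harmonicity leaves only the Euler terms, which give -d (d + N - 2), the classical
  eigenvalue on spherical harmonics of degree \<open>d\<close>. The inverse \<open>h\<close> of 2
  removes the factor 2 from \<open>two_MM_eq\<close>.\<close>

lemma MM_Y_poly:
  fixes a :: "nat \<Rightarrow> nat"
  assumes "i\<^sup>2 = (-1 :: 'a::comm_ring_1)" "\<epsilon> \<in> signs n" "N = 2 * n \<or> N = 2 * n + 1"
    and "(2 :: 'a) dvd 1"
  defines "d \<equiv> of_nat (\<Sum>j=1..n. a j)"
  shows "MM N (Y_poly i n \<epsilon> a) = Const (- (d * d + (of_nat N - 2) * d)) * Y_poly i n \<epsilon> a"
proof -
  let ?Y = "Y_poly i n \<epsilon> a"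
  obtain h :: 'a where h: "1 = 2 * h"
    using assms(4) by (auto simp: dvd_def)
  have h': "Const h * 2 = (1 :: 'a mpoly)"
    using arg_cong[OF h, of Const] by (metis Const_mult Const_of_nat Const_simps(2) mult.commute of_nat_numeral)
  have E: "euler N ?Y = Const d * ?Y"
    unfolding d_def Const_of_nat by (rule euler_Y_poly) (use assms(3) in auto)
  have c2: "Const (2 :: 'a) = 2"
    by (metis Const_of_nat of_nat_numeral)
  have "2 * MM N ?Y = 2 * (Const (- (d * d + (of_nat N - 2) * d)) * ?Y)"
    unfolding two_MM_eq laplacian_Y_poly[OF assms(1-3)] E derivationD(6)[OF derivation_euler]
    by (simp add: algebra_simps c2)
  then have "(Const h * 2) * MM N ?Y = (Const h * 2) * (Const (- (d * d + (of_nat N - 2) * d)) * ?Y)"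
    by (simp only: mult.assoc)
  then show ?thesis
    unfolding h' by simp
qed

subsection \<open>Diagonalisation\<close>

text \<open>The change of variables that puts u_j for X_{2j-1} and v_j for X_{2j}; the guard leaves
  X_{2n+1} fixed.\<close>

definition phi :: "'a::comm_ring_1 \<Rightarrow> nat \<Rightarrow> nat \<Rightarrow> 'a mpoly"
  where "phi i n k = (if k \<in> {1..2*n} then
     if odd k then Var k + Const i * Var (k + 1) else Var (k - 1) - Const i * Var k else Var k)"

text \<open>Inverse to \<open>phi\<close> when \<open>h = 1/2\<close>.\<close>

definition psi :: "'a::comm_ring_1 \<Rightarrow> 'a \<Rightarrow> nat \<Rightarrow> nat \<Rightarrow> 'a mpoly"
  where "psi i h n k = (if k \<in> {1..2*n} then
     if odd k then Const h * (Var k + Var (k + 1)) else Const (- h * i) * (Var (k - 1) - Var k)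
     else Var k)"

lemma pair_cases:
  fixes k n :: nat
  obtains j where "j \<in> {1..n}" "k = 2 * j - 1" | j where "j \<in> {1..n}" "k = 2 * j" | "k \<notin> {1..2*n}"
proof (cases "k \<in> {1..2*n}")
  case True
  show ?thesis
  proof (cases "odd k")
    case True
    then obtain j where "k = 2 * j + 1" by (rule oddE)
    with \<open>k \<in> {1..2*n}\<close> that(1)[of "j + 1"] show ?thesis by simp
  next
    case False
    then obtain j where "k = 2 * j" by (auto elim: evenE)
    with \<open>k \<in> {1..2*n}\<close> that(2)[of j] show ?thesis by simp
  qed
qed (use that(3) in blast)

lemma phi_simps:
  "j \<in> {1..n} \<Longrightarrow> phi i n (2 * j - 1) = Var (2 * j - 1) + Const i * Var (2 * j)"
  "j \<in> {1..n} \<Longrightarrow> phi i n (2 * j) = Var (2 * j - 1) - Const i * Var (2 * j)"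
  "k \<notin> {1..2*n} \<Longrightarrow> phi i n k = Var k"
proof -
  show "phi i n (2 * j - 1) = Var (2 * j - 1) + Const i * Var (2 * j)" if "j \<in> {1..n}"
  proof -
    \<comment> \<open>Writing \<open>j\<close> as a successor turns the truncated
      \<open>2 * j - 1\<close> into the visibly odd \<open>2 * l + 1\<close>.\<close>
    obtain l where "j = Suc l"
      using \<open>j \<in> {1..n}\<close> by (cases j) auto
    then show ?thesis
      using \<open>j \<in> {1..n}\<close> by (simp add: phi_def)
  qed
qed (auto simp: phi_def)

lemma psi_simps:
  "j \<in> {1..n} \<Longrightarrow> psi i h n (2 * j - 1) = Const h * (Var (2 * j - 1) + Var (2 * j))"
  "j \<in> {1..n} \<Longrightarrow> psi i h n (2 * j) = Const (- h * i) * (Var (2 * j - 1) - Var (2 * j))"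
  "k \<notin> {1..2*n} \<Longrightarrow> psi i h n k = Var k"
proof -
  show "psi i h n (2 * j - 1) = Const h * (Var (2 * j - 1) + Var (2 * j))" if "j \<in> {1..n}"
  proof -
    obtain l where "j = Suc l"
      using \<open>j \<in> {1..n}\<close> by (cases j) auto
    then show ?thesis
      using \<open>j \<in> {1..n}\<close> by (simp add: psi_def)
  qed
qed (auto simp: psi_def)

lemma Const_i_square: "i\<^sup>2 = -1 \<Longrightarrow> Const i * Const i = -1" for i :: "'a::comm_ring_1"
  by (metis Const_mult Const_simps(2,4) power2_eq_square)

lemma Const_half: "2 * h = 1 \<Longrightarrow> Const h + Const h = 1" for h :: "'a::comm_ring_1"
  by (metis Const_simps(2,3) mult_2)

text \<open>This direction makes \<open>subst (phi i n)\<close> injective, so that it can be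
  cancelled from an eigenvalue equation; the other one writes every polynomial in the new
  variables.\<close>

lemma subst_psi_phi:
  assumes i: "i\<^sup>2 = -1" and h: "2 * h = (1 :: 'a::comm_ring_1)"
  shows "subst (psi i h n) (subst (phi i n) p) = p"
proof -
  have "subst (psi i h n) (phi i n k) = Var k" for k
  proof (cases k rule: pair_cases[where n = n])
    case (1 j)
    let ?x = "Var (2 * j - 1) :: 'a mpoly" and ?y = "Var (2 * j) :: 'a mpoly"
    have "subst (psi i h n) (phi i n k)
        = Const h * (?x + ?y) - (Const i * Const i) * Const h * (?x - ?y)"
      using 1 by (simp only: phi_simps psi_simps subst_add subst_mult subst_Const subst_Var)
        (simp add: algebra_simps)
    also have "\<dots> = (Const h + Const h) * ?x"
      unfolding Const_i_square[OF i] by (simp add: algebra_simps)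
    finally show ?thesis
      using 1 by (simp only: Const_half[OF h] mult_1_left)
  next
    case (2 j)
    let ?x = "Var (2 * j - 1) :: 'a mpoly" and ?y = "Var (2 * j) :: 'a mpoly"
    have "subst (psi i h n) (phi i n k)
        = Const h * (?x + ?y) + (Const i * Const i) * Const h * (?x - ?y)"
      using 2 by (simp only: phi_simps psi_simps subst_add subst_minus subst_mult subst_Const subst_Var)
        (simp add: algebra_simps)
    also have "\<dots> = (Const h + Const h) * ?y"
      unfolding Const_i_square[OF i] by (simp add: algebra_simps)
    finally show ?thesis
      using 2 by (simp only: Const_half[OF h] mult_1_left)
  qed (simp add: phi_simps psi_simps)
  then show ?thesis
    by (simp add: subst_subst subst_Var_id)
qed

lemma subst_phi_psi:
  assumes i: "i\<^sup>2 = -1" and h: "2 * h = (1 :: 'a::comm_ring_1)"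
  shows "subst (phi i n) (subst (psi i h n) p) = p"
proof -
  have "subst (phi i n) (psi i h n k) = Var k" for k
  proof (cases k rule: pair_cases[where n = n])
    case (1 j)
    let ?x = "Var (2 * j - 1) :: 'a mpoly"
    have "subst (phi i n) (psi i h n k) = (Const h + Const h) * ?x"
      using 1 by (simp only: phi_simps psi_simps subst_add subst_mult subst_Const subst_Var)
        (simp add: algebra_simps)
    then show ?thesis
      using 1 by (simp only: Const_half[OF h] mult_1_left)
  next
    case (2 j)
    let ?y = "Var (2 * j) :: 'a mpoly"
    have "subst (phi i n) (psi i h n k) = - (Const i * Const i) * (Const h + Const h) * ?y"
      using 2 by (simp only: phi_simps psi_simps subst_add subst_minus subst_mult subst_Const subst_Var)
        (simp add: algebra_simps)
    then show ?thesis
      using 2 by (simp add: Const_half[OF h] Const_i_square[OF i])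
  qed (simp add: phi_simps psi_simps)
  then show ?thesis
    by (simp add: subst_subst subst_Var_id)
qed

text \<open>u_l and v_l are linear factors for the constant sign tuples 1 and -1, so
  \<open>M_lin\<close> applies to both; a variable outside the pairs is killed.\<close>

lemma M_phi:
  assumes i: "i\<^sup>2 = (-1 :: 'a::comm_ring_1)" and j: "j \<in> {1..n}"
  shows "M (2 * j - 1) (2 * j) (phi i n k)
    = Const (i * ((if k = 2 * j - 1 then 1 else 0) - (if k = 2 * j then 1 else 0))) * phi i n k"
proof (cases k rule: pair_cases[where n = n])
  case (1 l)
  then have "phi i n k = lin i (\<lambda>_. 1) l"
    by (simp add: phi_simps lin_def del: One_nat_def)
  moreover have "k \<noteq> 2 * j" "k = 2 * j - 1 \<longleftrightarrow> l = j"
    using 1 j odd_neq_even[of l j] odd_eq_odd_iff[of l j] by auto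
  ultimately show ?thesis
    using M_lin[OF i _ 1(1) j, of "\<lambda>_. 1"] by (simp add: signs_def del: One_nat_def)
next
  case (2 l)
  then have "phi i n k = lin i (\<lambda>_. -1) l"
    by (simp add: phi_simps lin_def del: One_nat_def)
  moreover have "k \<noteq> 2 * j - 1" "k = 2 * j \<longleftrightarrow> l = j"
    using 2 j odd_neq_even[of j l] by auto
  ultimately show ?thesis
    using M_lin[OF i _ 2(1) j, of "\<lambda>_. -1"] by (simp add: signs_def del: One_nat_def)
next
  case 3
  then have "2 * j - 1 \<noteq> k" "2 * j \<noteq> k"
    using j by auto
  then show ?thesis
    using 3 by (simp add: phi_simps M_def pd_Var)
qed

text \<open>The operator i (X_{2j-1} \<partial>_{2j-1} - X_{2j} \<partial>_{2j}), given by its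
  action on coefficients.\<close>

definition diag :: "'a::comm_ring_1 \<Rightarrow> nat \<Rightarrow> 'a mpoly \<Rightarrow> 'a mpoly"
  where "diag i j p = (\<Sum>m\<in>Poly_Mapping.keys p. Poly_Mapping.single m
    (i * (of_nat (Poly_Mapping.lookup m (2 * j - 1)) - of_nat (Poly_Mapping.lookup m (2 * j)))
     * Poly_Mapping.lookup p m))"

lemma lookup_diag:
  "Poly_Mapping.lookup (diag i j p) m =
    i * (of_nat (Poly_Mapping.lookup m (2 * j - 1)) - of_nat (Poly_Mapping.lookup m (2 * j)))
     * Poly_Mapping.lookup p m"
  by (simp add: diag_def lookup_sum lookup_single when_def in_keys_iff)

lemma subst_sum: "subst f (\<Sum>x\<in>A. g x) = (\<Sum>x\<in>A. subst f (g x))"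
  by (induction A rule: infinite_finite_induct) simp_all

lemma M_monval_phi:
  assumes i: "i\<^sup>2 = (-1 :: 'a::comm_ring_1)" and j: "j \<in> {1..n}"
  shows "M (2 * j - 1) (2 * j) (monval (phi i n) m) =
    Const (i * (of_nat (Poly_Mapping.lookup m (2 * j - 1)) - of_nat (Poly_Mapping.lookup m (2 * j))))
     * monval (phi i n) m"
proof -
  \<comment> \<open>If X_l does not occur in \<open>m\<close>, both sides are 0.\<close>
  have *: "(\<Sum>k\<in>Poly_Mapping.keys m. (if k = l then 1 else 0) * of_nat (Poly_Mapping.lookup m k))
      = (of_nat (Poly_Mapping.lookup m l) :: 'a)" for l
    by (simp add: if_distrib[of "\<lambda>x. x * _"] in_keys_iff cong: if_cong)
  have "(\<Sum>k\<in>Poly_Mapping.keys m. i * ((if k = 2 * j - 1 then 1 else 0) - (if k = 2 * j then 1 else 0))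
        * of_nat (Poly_Mapping.lookup m k))
      = i * (of_nat (Poly_Mapping.lookup m (2 * j - 1)) - of_nat (Poly_Mapping.lookup m (2 * j)))"
    unfolding mult.assoc left_diff_distrib sum_distrib_left[symmetric] sum_subtractf * ..
  with derivation_prod_eigen[OF derivation_M M_phi[OF i j], where A = "Poly_Mapping.keys m" and a = "Poly_Mapping.lookup m"]
  show ?thesis
    by (simp only: monval_def)
qed

text \<open>In the new variables M_{2j-1,2j} is diagonal on monomials, which reduces the eigenvector
  equation to a comparison of coefficients.\<close>

lemma M_subst_phi:
  assumes i: "i\<^sup>2 = (-1 :: 'a::comm_ring_1)" and j: "j \<in> {1..n}"
  shows "M (2 * j - 1) (2 * j) (subst (phi i n) p) = subst (phi i n) (diag i j p)"
  unfolding diag_def subst_sum subst_single subst_def[of _ p]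
    derivation_sum[OF derivation_M] derivationD(6)[OF derivation_M] M_monval_phi[OF i j] Const_mult
  by (simp only: ac_simps)

subsection \<open>Functions of the radii\<close>

lemma eval_poly_monval:
  "eval_poly f q = (\<Sum>m\<in>Poly_Mapping.keys q. Poly_Mapping.lookup q m * monval f m)"
  by (simp add: eval_poly_def monval_def)

lemma at_radii_add: "at_radii (p + q) = at_radii p + at_radii q"
  unfolding at_radii_def eval_poly_monval
  by (rule setsum_keys_plus_distrib) (simp_all add: algebra_simps)

lemma at_radii_sum: "at_radii (\<Sum>x\<in>A. g x) = (\<Sum>x\<in>A. at_radii (g x))"
  by (induction A rule: infinite_finite_induct)
    (simp_all add: at_radii_add, simp_all add: at_radii_def eval_poly_def)

lemma at_radii_single:
  "at_radii (Poly_Mapping.single m c) = c * monval (\<lambda>k. Var (2 * k - 1) ^ 2 + Var (2 * k) ^ 2) m"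
  by (simp add: at_radii_def eval_poly_monval)

lemma monval_sum: "monval f (\<Sum>x\<in>A. g x) = (\<Prod>x\<in>A. monval f (g x))"
  by (induction A rule: infinite_finite_induct) (simp_all add: monval_add)

text \<open>From a monomial in the u and v, the largest power of u_j v_j is split off for each j;
  its exponent becomes that of T_j.\<close>

definition radial :: "nat \<Rightarrow> (nat \<Rightarrow>\<^sub>0 nat) \<Rightarrow> nat \<Rightarrow>\<^sub>0 nat"
  where "radial n m = (\<Sum>j=1..n. Poly_Mapping.single j
    (min (Poly_Mapping.lookup m (2 * j - 1)) (Poly_Mapping.lookup m (2 * j))))"

lemma keys_radial: "Poly_Mapping.keys (radial n m) \<subseteq> {1..n}"
  unfolding radial_def by (rule order.trans[OF keys_sum]) auto

text \<open>The common part of the two powers is a power of the product, and the excess of the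
  larger exponent remains. The excess is an absolute value so as to match a_j = |\<delta>_j|
  below.\<close>

lemma pow_factor:
  fixes u v w :: "'b::comm_monoid_mult"
  assumes "u * v = w"
  shows "u ^ p * v ^ q = (if q \<le> p then u else v) ^ nat \<bar>int p - int q\<bar> * w ^ min p q"
proof (cases "q \<le> p")
  case True
  then have "nat \<bar>int p - int q\<bar> = p - q" "u ^ p = u ^ (p - q) * u ^ q"
    by (simp_all flip: power_add)
  then show ?thesis
    using True by (simp add: power_mult_distrib ac_simps flip: assms)
next
  case False
  then have "nat \<bar>int p - int q\<bar> = q - p" "v ^ q = v ^ (q - p) * v ^ p"
    by (simp_all flip: power_add)
  then show ?thesis
    using False by (simp add: power_mult_distrib ac_simps flip: assms)
qed

text \<open>The factor \<open>Y_poly\<close> depends on the exponent differences \<delta> alone, so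
  monomials with equal differences share it. A difference 0 gets the sign 1, where the exponent 0
  makes the choice immaterial.\<close>

lemma monval_phi_eq:
  assumes i: "i\<^sup>2 = (-1 :: 'a::comm_ring_1)"
    and keys: "Poly_Mapping.keys m \<subseteq> {1..2*n+1}"
    and \<delta>: "\<And>j. j \<in> {1..n} \<Longrightarrow>
      int (Poly_Mapping.lookup m (2 * j - 1)) - int (Poly_Mapping.lookup m (2 * j)) = \<delta> j"
  shows "monval (phi i n) m = Y_poly i n (\<lambda>j. if \<delta> j \<ge> 0 then 1 else -1) (\<lambda>j. nat \<bar>\<delta> j\<bar>) *
    (Var (2*n+1) ^ Poly_Mapping.lookup m (2*n+1)
      * monval (\<lambda>k. Var (2 * k - 1) ^ 2 + Var (2 * k) ^ 2) (radial n m))"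
proof -
  let ?e = "\<lambda>j. if \<delta> j \<ge> 0 then 1 else -1 :: int"
  have pair: "phi i n (2 * j - 1) ^ Poly_Mapping.lookup m (2 * j - 1) * phi i n (2 * j) ^ Poly_Mapping.lookup m (2 * j)
      = lin i ?e j ^ nat \<bar>\<delta> j\<bar> * (Var (2 * j - 1) ^ 2 + Var (2 * j) ^ 2)
        ^ min (Poly_Mapping.lookup m (2 * j - 1)) (Poly_Mapping.lookup m (2 * j))" if j: "j \<in> {1..n}" for j
  proof -
    have "phi i n (2 * j - 1) * phi i n (2 * j) = Var (2 * j - 1) ^ 2 - (Const i * Const i) * Var (2 * j) ^ 2"
      unfolding phi_simps(1,2)[OF j] by (simp add: algebra_simps power2_eq_square)
    then have uv: "phi i n (2 * j - 1) * phi i n (2 * j) = Var (2 * j - 1) ^ 2 + Var (2 * j) ^ 2"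
      unfolding Const_i_square[OF i] by simp
    \<comment> \<open>The sign chosen by \<delta>_j \<ge> 0 selects the same factor as the case
      distinction in \<open>pow_factor\<close>.\<close>
    have "lin i ?e j = (if Poly_Mapping.lookup m (2 * j) \<le> Poly_Mapping.lookup m (2 * j - 1)
        then phi i n (2 * j - 1) else phi i n (2 * j))"
      unfolding lin_def phi_simps(1,2)[OF j] using \<delta>[OF j] by auto
    then show ?thesis
      unfolding pow_factor[OF uv] \<delta>[OF j] by simp
  qed
  have "monval (phi i n) m = (\<Prod>k=1..2*n+1. phi i n k ^ Poly_Mapping.lookup m k)"
    by (rule monval_superset) (use keys in auto)
  also have "\<dots> = (\<Prod>j=1..n. phi i n (2 * j - 1) ^ Poly_Mapping.lookup m (2 * j - 1)
      * phi i n (2 * j) ^ Poly_Mapping.lookup m (2 * j)) * Var (2*n+1) ^ Poly_Mapping.lookup m (2*n+1)"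
    by (simp add: phi_simps(3) prod_pairs[of "\<lambda>k. phi i n k ^ Poly_Mapping.lookup m k", simplified])
  also have "(\<Prod>j=1..n. phi i n (2 * j - 1) ^ Poly_Mapping.lookup m (2 * j - 1)
      * phi i n (2 * j) ^ Poly_Mapping.lookup m (2 * j)) =
      (\<Prod>j=1..n. lin i ?e j ^ nat \<bar>\<delta> j\<bar> * (Var (2 * j - 1) ^ 2 + Var (2 * j) ^ 2)
        ^ min (Poly_Mapping.lookup m (2 * j - 1)) (Poly_Mapping.lookup m (2 * j)))"
    by (rule prod.cong) (use pair in auto)
  finally show ?thesis
    by (simp add: radial_def monval_sum Y_poly_lin prod.distrib ac_simps)
qed

section \<open>Joint eigenvectors in diagonal form\<close>

lemma lookup_R_star_sum:
  fixes g :: "'b \<Rightarrow> 'a::comm_ring_1 mpoly"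
  assumes "\<And>x. x \<in> A \<Longrightarrow> g x \<in> R_star N n"
  shows "Poly_Mapping.lookup (\<Sum>x\<in>A. Poly_Mapping.single (f x) (g x)) m \<in> R_star N n"
proof -
  define V where "V = (if N = 2 * n then {} else {2 * n + 1})"
  have V: "R_star N n = (polys V :: 'a mpoly set)"
    by (simp add: R_star_def V_def)
  \<comment> \<open>Several \<open>x\<close> may share the exponent \<open>f x\<close>, so a
    coefficient is a sum of values of \<open>g\<close>; in both cases \<open>R_star\<close> is some
    \<open>polys V\<close> and closed under sums.\<close>
  show ?thesis
    unfolding V lookup_sum
    by (rule polys_sum) (use assms in \<open>auto simp: V lookup_single when_def\<close>)
qed

lemma joint_eigenvector_form:
  assumes i: "i\<^sup>2 = (-1 :: 'a::comm_ring_1)" and N: "N = 2 * n \<or> N = 2 * n + 1" and "n \<ge> 1"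
    and dom: "\<forall>x y :: 'a. x * y = 0 \<longrightarrow> x = 0 \<or> y = 0" and "(2::'a) dvd 1" and char: "CHAR('a) = 0"
    and eig: "\<forall>j\<in>{1..n}. eigenvector N (M (2*j - 1) (2*j)) Y"
  shows "\<exists>\<epsilon>\<in>signs n. \<exists>a. \<exists>q\<in>R_star_polys N n. Y = Y_poly i n \<epsilon> a * at_radii q"
proof -
  obtain h :: 'a where h: "2 * h = 1"
    using assms(5) by (auto simp: dvd_def)
  \<comment> \<open>\<open>Z\<close> is \<open>Y\<close> rewritten as a polynomial in the u_j, the
    v_j and possibly X_{2n+1}.\<close>
  define Z where "Z = subst (psi i h n) Y"
  have Y: "Y = subst (phi i n) Z"
    by (simp add: Z_def subst_phi_psi[OF i h])
  \<comment> \<open>Membership in R[X_1,...,X_N] and \<open>Y \<noteq> 0\<close> come with being an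
    eigenvector; as \<open>n \<ge> 1\<close>, the index 1 provides them.\<close>
  have "eigenvector N (M (2 * 1 - 1) (2 * 1)) Y"
    using eig \<open>n \<ge> 1\<close> by (meson atLeastAtMost_iff order_refl)
  then have "Y \<in> polys {1..N}" "Y \<noteq> 0"
    by (simp_all add: eigenvector_def)
  have "psi i h n k \<in> polys {1..N}" if "k \<in> {1..N}" for k
    using that
  proof (cases k rule: pair_cases[where n = n])
    case (1 j)
    then show ?thesis
      unfolding 1(2) psi_simps(1)[OF 1(1)]
      using N by (intro polys_mult polys_Const polys_add polys_Var) auto
  next
    case (2 j)
    then show ?thesis
      unfolding 2(2) psi_simps(2)[OF 2(1)]
      using N by (intro polys_mult polys_Const polys_minus polys_Var) auto
  qed (simp add: psi_simps polys_Var)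
  then have Z: "Z \<in> polys {1..N}"
    unfolding Z_def using \<open>Y \<in> polys {1..N}\<close> by (rule subst_in_polys[rotated])
  have "Z \<noteq> 0"
    using Y \<open>Y \<noteq> 0\<close> by auto
  then obtain m0 where m0: "m0 \<in> Poly_Mapping.keys Z"
    by (metis ex_in_conv in_keys_iff lookup_zero poly_mapping_eqI)
  \<comment> \<open>Any monomial of \<open>Z\<close> may serve as reference: the exponent
    differences of all others will turn out the same.\<close>
  define \<delta> where "\<delta> j = int (Poly_Mapping.lookup m0 (2 * j - 1)) - int (Poly_Mapping.lookup m0 (2 * j))" for j
  have \<delta>: "int (Poly_Mapping.lookup m (2 * j - 1)) - int (Poly_Mapping.lookup m (2 * j)) = \<delta> j"
    if m: "m \<in> Poly_Mapping.keys Z" and j: "j \<in> {1..n}" for m j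
  proof -
    obtain c where "M (2 * j - 1) (2 * j) Y = Const c * Y"
      using eig j unfolding eigenvector_def by blast
    then have "subst (phi i n) (diag i j Z) = subst (phi i n) (Const c * Z)"
      by (simp add: Y M_subst_phi[OF i j] del: One_nat_def)
    then have diag: "diag i j Z = Const c * Z"
      by (metis subst_psi_phi[OF i h])
    let ?d = "\<lambda>m. of_nat (Poly_Mapping.lookup m (2 * j - 1)) - of_nat (Poly_Mapping.lookup m (2 * j)) :: 'a"
    \<comment> \<open>Comparing coefficients at \<open>l\<close> and using that there are no zero
      divisors gives i d = c; multiplying by \<open>i\<close> solves for the difference d.\<close>
    have d: "?d l = - (i * c)" if "l \<in> Poly_Mapping.keys Z" for l
    proof -
      have "i * ?d l * Poly_Mapping.lookup Z l = c * Poly_Mapping.lookup Z l"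
        using arg_cong[OF diag, of "\<lambda>p. Poly_Mapping.lookup p l"] by (simp add: lookup_diag)
      then have "(i * ?d l - c) * Poly_Mapping.lookup Z l = 0"
        by (simp add: algebra_simps)
      moreover have "Poly_Mapping.lookup Z l \<noteq> 0"
        using that by (simp add: in_keys_iff)
      ultimately have "i * ?d l = c"
        using dom by (metis eq_iff_diff_eq_0)
      then have "i * c = (i * i) * ?d l"
        by (simp add: mult.assoc)
      then show ?thesis
        using i by (simp add: power2_eq_square)
    qed
    have "?d m = ?d m0"
      using d[OF m] d[OF m0] by simp
    then have "of_nat (Poly_Mapping.lookup m (2 * j - 1) + Poly_Mapping.lookup m0 (2 * j))
        = (of_nat (Poly_Mapping.lookup m0 (2 * j - 1) + Poly_Mapping.lookup m (2 * j)) :: 'a)"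
      by (simp add: algebra_simps)
    \<comment> \<open>Characteristic 0 recovers natural numbers from their images in
      \<open>R\<close>: both truncated differences have image 0, hence are 0.\<close>
    moreover have inj: "x = y" if "of_nat x = (of_nat y :: 'a)" for x y
    proof -
      have "of_nat (y - x) = (0::'a)" "of_nat (x - y) = (0::'a)"
        using that by (metis diff_is_0_eq' diff_self nle_le of_nat_0 of_nat_diff)+
      then have "y - x = 0" "x - y = 0"
        unfolding of_nat_eq_0_iff_char_dvd char by simp_all
      then show ?thesis
        by simp
    qed
    ultimately have "Poly_Mapping.lookup m (2 * j - 1) + Poly_Mapping.lookup m0 (2 * j)
        = Poly_Mapping.lookup m0 (2 * j - 1) + Poly_Mapping.lookup m (2 * j)"
      by blast
    then show ?thesis
      by (simp add: \<delta>_def)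
  qed
  define \<epsilon> where "\<epsilon> = (\<lambda>j. if \<delta> j \<ge> 0 then 1 else -1 :: int)"
  define a where "a = (\<lambda>j. nat \<bar>\<delta> j\<bar>)"
  \<comment> \<open>The coefficient in R_* contributed by \<open>m\<close>: its scalar times its
    power of X_{2n+1}. The radial part of \<open>m\<close> is its exponent in
    \<open>q\<close>.\<close>
  define g where "g = (\<lambda>m. Const (Poly_Mapping.lookup Z m) * Var (2*n+1) ^ Poly_Mapping.lookup m (2*n+1))"
  define q where "q = (\<Sum>m\<in>Poly_Mapping.keys Z. Poly_Mapping.single (radial n m) (g m))"
  have "Y = (\<Sum>m\<in>Poly_Mapping.keys Z. Const (Poly_Mapping.lookup Z m) * monval (phi i n) m)"
    unfolding Y subst_def ..
  also have "\<dots> = (\<Sum>m\<in>Poly_Mapping.keys Z. Y_poly i n \<epsilon> a * at_radii (Poly_Mapping.single (radial n m) (g m)))"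
  proof (rule sum.cong)
    fix m assume m: "m \<in> Poly_Mapping.keys Z"
    then have "Poly_Mapping.keys m \<subseteq> {1..N}"
      using Z by (simp add: polys_def)
    then have "Poly_Mapping.keys m \<subseteq> {1..2*n+1}"
      using N by force
    from monval_phi_eq[OF i this, of \<delta>, OF \<delta>[OF m]]
    show "Const (Poly_Mapping.lookup Z m) * monval (phi i n) m
        = Y_poly i n \<epsilon> a * at_radii (Poly_Mapping.single (radial n m) (g m))"
      unfolding at_radii_single g_def by (simp add: \<epsilon>_def a_def ac_simps)
  qed simp
  also have "\<dots> = Y_poly i n \<epsilon> a * at_radii q"
    by (simp add: q_def at_radii_sum sum_distrib_left)
  finally have "Y = Y_poly i n \<epsilon> a * at_radii q" .
  moreover have "\<epsilon> \<in> signs n"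
    by (simp add: \<epsilon>_def signs_def)
  moreover have "q \<in> R_star_polys N n"
  proof -
    have "Poly_Mapping.single (radial n m) (g m) \<in> polys {1..n}" for m
      using keys_radial[of n m] by (auto simp: polys_def)
    then have "q \<in> polys {1..n}"
      unfolding q_def by (intro polys_sum)
    moreover have "g m \<in> R_star N n" if m: "m \<in> Poly_Mapping.keys Z" for m
    proof (cases "N = 2 * n")
      case True
      \<comment> \<open>The variables of \<open>Z\<close> have index at most \<open>2 * n\<close>,
        so the power in \<open>g m\<close> is 1 and \<open>g m\<close> is constant.\<close>
      then have "2 * n + 1 \<notin> Poly_Mapping.keys m"
        using Z m by (force simp: polys_def)
      then have "g m = Const (Poly_Mapping.lookup Z m)"
        by (simp add: g_def in_keys_iff)
      then show ?thesis
        by (simp add: R_star_def)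
    next
      case False
      have "g m \<in> polys {2 * n + 1}"
        unfolding g_def by (intro polys_mult polys_Const polys_power polys_Var) simp
      then show ?thesis
        using False by (simp add: R_star_def)
    qed
    then have "Poly_Mapping.lookup q m \<in> R_star N n" for m
      unfolding q_def by (rule lookup_R_star_sum)
    ultimately show ?thesis
      by (simp add: R_star_polys_def)
  qed
  ultimately show ?thesis
    by blast
qed

text \<open>The existence claim of (b) is stated for characteristic 0. In odd characteristic p the
  polynomial 1 + (X_1 + i X_2)^p is killed by every M_{2j-1,2j} but has no such factorisation: the
  exponents 0 and p have the same image in \<open>R\<close>. The homogeneous claim covers every
  factorisation of the given shape.\<close>

theorem proposition3p2:
  fixes i :: "'a::comm_ring_1" and N n :: nat
  assumes "i\<^sup>2 = -1" and "N \<ge> 2" and "n = N div 2"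
  shows
    "(\<forall>\<epsilon>\<in>signs n. \<forall>a. \<forall>j\<in>{1..n}.
        M (2*j - 1) (2*j) (Y_poly i n \<epsilon> a)
          = Const (i * of_int (\<epsilon> j) * of_nat (a j)) * Y_poly i n \<epsilon> a)
     \<and>
     ((\<forall>x y :: 'a. x * y = 0 \<longrightarrow> x = 0 \<or> y = 0) \<and> (2::'a) dvd 1 \<longrightarrow>
       (\<forall>Y. (\<forall>j\<in>{1..n}. eigenvector N (M (2*j - 1) (2*j)) Y) \<longrightarrow>
          (CHAR('a) = 0 \<longrightarrow>
             (\<exists>\<epsilon>\<in>signs n. \<exists>a. \<exists>q\<in>R_star_polys N n. Y = Y_poly i n \<epsilon> a * at_radii q)) \<and>
          (\<forall>\<epsilon>\<in>signs n. \<forall>a. \<forall>q\<in>R_star_polys N n.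
             Y = Y_poly i n \<epsilon> a * at_radii q \<and> homogeneous (\<Sum>j=1..n. a j) Y \<longrightarrow>
             (\<exists>c. Y = Const c * Y_poly i n \<epsilon> a)))
       \<and>
       (\<forall>\<epsilon>\<in>signs n. \<forall>a.
          laplacian N (Y_poly i n \<epsilon> a) = 0 \<and>
          homogeneous (\<Sum>j=1..n. a j) (Y_poly i n \<epsilon> a) \<and>
          eigenvector N (MM N) (Y_poly i n \<epsilon> a)))"
proof -
  have N: "N = 2 * n \<or> N = 2 * n + 1" "n \<ge> 1"
    using assms(2,3) by auto
  have b1: "\<exists>\<epsilon>\<in>signs n. \<exists>a. \<exists>q\<in>R_star_polys N n. Y = Y_poly i n \<epsilon> a * at_radii q"
    if "\<forall>x y :: 'a. x * y = 0 \<longrightarrow> x = 0 \<or> y = 0" "(2::'a) dvd 1" "CHAR('a) = 0"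
      "\<forall>j\<in>{1..n}. eigenvector N (M (2*j - 1) (2*j)) Y" for Y
    using joint_eigenvector_form[OF assms(1) N that] .
  \<comment> \<open>The scalar is the constant coefficient of \<open>at_radii q\<close>, since
    \<open>Y\<close> and \<open>Y_poly\<close> are homogeneous of the same degree.\<close>
  have b2: "\<exists>c. Y = Const c * Y_poly i n \<epsilon> a"
    if "Y = Y_poly i n \<epsilon> a * at_radii q" "homogeneous (\<Sum>j=1..n. a j) Y" for Y \<epsilon> a q
    using homogeneous_factor[OF homogeneous_Y_poly] that by blast
  have c: "eigenvector N (MM N) (Y_poly i n \<epsilon> a)" if "\<epsilon> \<in> signs n" "(2::'a) dvd 1" for \<epsilon> a
    unfolding eigenvector_def
  proof (intro conjI exI)
    show "Y_poly i n \<epsilon> a \<in> polys {1..N}"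
      by (rule Y_poly_in_polys) (use N in auto)
  qed (rule Y_poly_nonzero, rule MM_Y_poly[OF assms(1) that(1) N(1) that(2)])
  show ?thesis
    by (intro conjI impI allI ballI; (elim conjE)?;
      rule M_Y_poly[OF assms(1)] b1 b2 c laplacian_Y_poly[OF assms(1) _ N(1)] homogeneous_Y_poly;
      assumption)
qed

end
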